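(* Let $(x_k),(y_k),(v_k),(A_k),(\gamma_k)$ be generated by the Optimized Gradient Method with Memory (described in the context), and let $\bar{\mathcal D}_1=\frac{2}{\gamma_1}\mathcal D_1$, where $$\mathcal D_1 = A_1\left(f(y_1)-f^*-\frac{\mu r}{2}\|x^*-x_1\|^2-\frac{1}{2L_f}\|g_1\|_*^2\right)+\frac{\gamma_1}{2}\|v_1-x^*\|^2 .$$ Then the method has the following worst-case guarantees (the same as those of the memory-less generalized Optimized Gradient Method). (i) If $\mu=0$, then $f(x_k)-f^*\le \frac{L_f}{k^2}\bar{\mathcal D}_1$ for all generated iterates with $k\ge2$. (ii) If $\mu>0$ and $\gamma_1\ge2\mu rA_1$, then for all generated iterates with $k\ge2$ $$\|v_k-x^*\|^2\le(1-\sqrt q)^{2k-4}\frac{(1-q)^2}{4q}\bar{\mathcal D}_1,\qquad f(v_k)-f^*\le(1-\sqrt q)^{2k-4}\frac{(1-q)^2L_f}{8q}\bar{\mathcal D}_1 .$$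
   Context: $\mathbb E$ is a finite-dimensional real vector space with dual $\mathbb E^*$, $\langle g,x\rangle$ is the value of $g\in\mathbb E^*$ at $x\in\mathbb E$, and $B:\mathbb E\to\mathbb E^*$ is self-adjoint positive definite. Norms: $\|x\|=\sqrt{\langle Bx,x\rangle}$, $\|g\|_*=\sqrt{\langle g,B^{-1}g\rangle}$. The function $f:\mathbb E\to\mathbb R$ is convex and differentiable, and for given $L_f>0$, $\mu\in[0,L_f)$ satisfies, for all $z_1,z_2\in\mathbb E$, $$\frac{\mu}{2}\|z_1-z_2\|^2\le f(z_1)-f(z_2)-\langle f'(z_2),z_1-z_2\rangle\le\frac{L_f}{2}\|z_1-z_2\|^2 .$$ $x^*$ is a fixed minimizer of $f$ (assumed to exist), $f^*=f(x^* )$, $q=\mu/L_f$, $r=L_f/(L_f-\mu)$. $\Delta_m$ is the standard simplex in $\mathbb R^m$ (nonnegative weights summing to 1). Optimized Gradient Method with Memory. Input: $x_0\in\mathbb E$, $A_1\ge0$, $\gamma_1>0$. Set $y_1=x_0$, $g_1=f'(y_1)$, $x_1=y_1-\frac1{L_f}B^{-1}g_1$, and choose any $v_1\in\mathbb E$. Throughout, for every $j\ge1$, $g_j=f'(y_j)$, $x_j=y_j-\frac1{L_f}B^{-1}g_j$ and $\hat h_j=\frac{\mu r}2(\|x_j\|^2-\|v_1\|^2)+\frac1{2L_f}\|g_j\|_*^2$, $\hat g_j=\mu rB(v_1-x_j)$, $\bar h_j=\hat h_j+f(y_j)-\langle g_j,y_j\rangle$, $\bar g_j=\hat g_j+g_j$.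 Also $\gamma(A)=\gamma_1+2\mu r(A-A_1)$. A model with $m_k$ entries is a pair $(H_k,G_k)$, $H_k\in\mathbb R^{m_k}$, $G_k\in(\mathbb E^* )^{m_k}$; write $\langle H_k,\lambda\rangle=\sum_i\lambda_i(H_k)_i$ and $G_k\lambda=\sum_i\lambda_i(G_k)_i$. For $A>0$, $A\ge A_1$, $\lambda\in\Delta_{m_k}$, let $$\omega_k(x,A,\lambda)=\tfrac{A-A_1}{A}\left(\langle H_k,\lambda\rangle+\langle G_k\lambda,x\rangle\right)+\hat h_k+\langle\hat g_k,x\rangle+\tfrac{A_1}{A}\left(f(y_1)-\hat h_1-\langle\hat g_1,x\rangle\right)+\tfrac{\gamma(A)}{2A}\|x-v_1\|^2,$$ and let $\phi_k(A,\lambda)=\min_{x\in\mathbb E}\omega_k(x,A,\lambda)-f(y_k)$, with $\phi_k'(A,\lambda)$ its derivative in $A$ at fixed $\lambda$. For $k=1,2,\dots$: 1. $a_{k+1}=\frac{1}{L_f-\mu}\left(\gamma_k+\mu A_k+\sqrt{\gamma_k(\gamma_k+2L_fA_k)}\right)$. With $\gamma^{+}=\gamma_k+2\mu ra_{k+1}$, $\bar a_{k+1}=(1+2qr)a_{k+1}+qrA_k$, $\bar\gamma_{k+1}=\gamma^{+}-\mu\bar a_{k+1}$, set $y_{k+1}=(rA_k\bar\gamma_{k+1}+\bar a_{k+1}\gamma_k)^{-1}(rA_k\bar\gamma_{k+1}x_k+\bar a_{k+1}\gamma_kv_k)$ and compute $g_{k+1},x_{k+1},\hat h_{k+1},\hat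 g_{k+1},\bar h_{k+1},\bar g_{k+1}$. 2. If $k=1$, the model is the single entry $H_2=\bar h_2$, $G_2=\bar g_2$, and $\lambda^{(0)}_2=1$. If $k\ge2$, form a model $(H_{k+1},G_{k+1})$ whose first entry is $(\tilde h_k,\tilde g_k)=(\langle H_k,\lambda_k\rangle,G_k\lambda_k)$, whose second entry is $(\bar h_{k+1},\bar g_{k+1})$, and whose remaining entries (if any) are convex combinations of the pairs $(\bar h_j,\bar g_j)$, $1\le j\le k+1$; put $\lambda^{(0)}_{k+1}=\frac{1}{A_k+a_{k+1}-A_1}(A_k-A_1,a_{k+1},0,\dots,0)^T$. 3. (Newton middle scheme, at most $N$ steps.) Start with $A=A_{\mathrm{valid}}=A_k+a_{k+1}$ and $\lambda_{\mathrm{valid}}=\lambda^{(0)}_{k+1}$. For $t=1,\dots,N$: obtain some $\lambda\in\Delta_{m_{k+1}}$ (an approximate maximizer of $\phi_{k+1}(A,\cdot)$, with no accuracy requirement); if $\phi_{k+1}(A,\lambda)<0$ stop; otherwise set $\lambda_{\mathrm{valid}}=\lambda$, $A_{\mathrm{valid}}=A$; if $\phi_{k+1}'(A,\lambda)\ge0$ stop; otherwise replace $A$ by $A-\phi_{k+1}(A,\lambda)/\phi_{k+1}'(A,\lambda)$. Output $\lambda_{k+1}=\lambda_{\mathrm{valid}}$, $A_{k+1}=A_{\mathrm{valid}}$. 4. $\gamma_{k+1}=\gamma_1+2\mu r(A_{k+1}-A_1)$ and $v_{k+1}=v_1-\frac{A_{k+1}}{\gamma_{k+1}}B^{-1}\rho_{k+1}$,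 where $\rho_{k+1}=\left(1-\frac{A_1}{A_{k+1}}\right)G_{k+1}\lambda_{k+1}+\hat g_{k+1}-\frac{A_1}{A_{k+1}}\hat g_1$. *)

theory Defs
  imports "HOL-Analysis.Analysis"
begin

text \<open>
  The dual space is the type of (bounded) linear functionals \<open>'a \<Rightarrow>\<^sub>L real\<close>; the value of \<open>g\<close> at
  \<open>x\<close> is the application \<open>g x\<close>. The inner product that the class \<^class>\<open>euclidean_space\<close> puts
  on the primal space is never used: the geometry comes from \<open>B\<close>.
\<close>

definition norm_B :: "('a::euclidean_space \<Rightarrow> ('a \<Rightarrow>\<^sub>L real)) \<Rightarrow> 'a \<Rightarrow> real" where
  "norm_B B x = sqrt (B x x)"

definition dual_norm_B :: "('a::euclidean_space \<Rightarrow> ('a \<Rightarrow>\<^sub>L real)) \<Rightarrow> ('a \<Rightarrow>\<^sub>L real) \<Rightarrow> real" where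
  "dual_norm_B B g = sqrt (g (inv B g))"

text \<open>Vectors of length \<open>m\<close> are functions on \<^typ>\<open>nat\<close> of which only the entries \<open>1, \<dots>, m\<close> matter.\<close>

definition std_simplex :: "nat \<Rightarrow> (nat \<Rightarrow> real) set" where
  "std_simplex m = {l. (\<forall>i\<in>{1..m}. 0 \<le> l i) \<and> (\<Sum>i=1..m. l i) = 1}"

text \<open>
  \<open>newton_middle \<phi> \<phi>' \<Lambda> n \<tau> l\<^sub>v \<tau>\<^sub>v l \<tau>\<^sub>o\<close>: with at most \<open>n\<close> steps left, current point \<open>\<tau>\<close> and last
  valid pair \<open>(l\<^sub>v, \<tau>\<^sub>v)\<close>, the scheme may output \<open>(l, \<tau>\<^sub>o)\<close>. It is a relation because the weights
  found by the inner solver are an arbitrary element of \<open>\<Lambda>\<close> at every step.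
\<close>

inductive newton_middle ::
  "(real \<Rightarrow> 'l \<Rightarrow> real) \<Rightarrow> (real \<Rightarrow> 'l \<Rightarrow> real) \<Rightarrow> 'l set \<Rightarrow>
   nat \<Rightarrow> real \<Rightarrow> 'l \<Rightarrow> real \<Rightarrow> 'l \<Rightarrow> real \<Rightarrow> bool"
  for \<phi> \<phi>' :: "real \<Rightarrow> 'l \<Rightarrow> real" and \<Lambda> :: "'l set" where
  exhausted: "newton_middle \<phi> \<phi>' \<Lambda> 0 \<tau> lv \<tau>v lv \<tau>v"
| invalid: "\<lbrakk>l \<in> \<Lambda>; \<phi> \<tau> l < 0\<rbrakk> \<Longrightarrow> newton_middle \<phi> \<phi>' \<Lambda> (Suc n) \<tau> lv \<tau>v lv \<tau>v"
| nondecreasing: "\<lbrakk>l \<in> \<Lambda>; \<phi> \<tau> l \<ge> 0; \<phi>' \<tau> l \<ge> 0\<rbrakk> \<Longrightarrow> newton_middle \<phi> \<phi>' \<Lambda> (Suc n) \<tau> lv \<tau>v l \<tau>"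
| update: "\<lbrakk>l \<in> \<Lambda>; \<phi> \<tau> l \<ge> 0; \<phi>' \<tau> l < 0;
            newton_middle \<phi> \<phi>' \<Lambda> n (\<tau> - \<phi> \<tau> l / \<phi>' \<tau> l) l \<tau> lo \<tau>o\<rbrakk>
           \<Longrightarrow> newton_middle \<phi> \<phi>' \<Lambda> (Suc n) \<tau> lv \<tau>v lo \<tau>o"

locale ogm_problem =
  fixes f :: "'a::euclidean_space \<Rightarrow> real"
    and f' :: "'a \<Rightarrow> ('a \<Rightarrow>\<^sub>L real)"
    and B :: "'a \<Rightarrow> ('a \<Rightarrow>\<^sub>L real)"
    and L \<mu> :: real
    and xstar :: 'a
  assumes B_linear: "linear B"
    and B_self_adjoint: "\<And>x y. B x y = B y x"
    and B_pos_def: "\<And>x. x \<noteq> 0 \<Longrightarrow> B x x > 0"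
    and L_pos: "L > 0"
    and mu_nonneg: "\<mu> \<ge> 0"
    and mu_less_L: "\<mu> < L"
    and f_convex: "convex_on UNIV f"
    and f_deriv: "\<And>x. (f has_derivative blinfun_apply (f' x)) (at x)"
    and f_lower: "\<And>z1 z2. \<mu> / 2 * (norm_B B (z1 - z2))\<^sup>2 \<le> f z1 - f z2 - f' z2 (z1 - z2)"
    and f_upper: "\<And>z1 z2. f z1 - f z2 - f' z2 (z1 - z2) \<le> L / 2 * (norm_B B (z1 - z2))\<^sup>2"
    and xstar_min: "\<And>x. f xstar \<le> f x"

text \<open>
  Sequences are indexed from 1, as in the method; their values at 0 are irrelevant. The model with
  index \<open>k\<close> has the \<open>m k\<close> entries \<open>(H k i, G k i)\<close> with \<open>1 \<le> i \<le> m k\<close>.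
\<close>

locale ogm_memory_data = ogm_problem f f' B L \<mu> xstar
  for f :: "'a::euclidean_space \<Rightarrow> real" and f' B L \<mu> xstar +
  fixes x y v :: "nat \<Rightarrow> 'a"
    and A \<gamma> :: "nat \<Rightarrow> real"
    and m :: "nat \<Rightarrow> nat"
    and H :: "nat \<Rightarrow> nat \<Rightarrow> real"
    and G :: "nat \<Rightarrow> nat \<Rightarrow> ('a \<Rightarrow>\<^sub>L real)"
    and lam :: "nat \<Rightarrow> nat \<Rightarrow> real"
begin

definition q :: real where "q = \<mu> / L"

definition r :: real where "r = L / (L - \<mu>)"

definition g :: "nat \<Rightarrow> ('a \<Rightarrow>\<^sub>L real)" where "g j = f' (y j)"

definition h_hat :: "nat \<Rightarrow> real" where
  "h_hat j = \<mu> * r / 2 * ((norm_B B (x j))\<^sup>2 - (norm_B B (v 1))\<^sup>2) + 1 / (2 * L) * (dual_norm_B B (g j))\<^sup>2"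

definition g_hat :: "nat \<Rightarrow> ('a \<Rightarrow>\<^sub>L real)" where
  "g_hat j = (\<mu> * r) *\<^sub>R B (v 1 - x j)"

definition h_bar :: "nat \<Rightarrow> real" where
  "h_bar j = h_hat j + f (y j) - g j (y j)"

definition g_bar :: "nat \<Rightarrow> ('a \<Rightarrow>\<^sub>L real)" where
  "g_bar j = g_hat j + g j"

definition gamma_of :: "real \<Rightarrow> real" where
  "gamma_of \<tau> = \<gamma> 1 + 2 * \<mu> * r * (\<tau> - A 1)"

definition H_comb :: "nat \<Rightarrow> (nat \<Rightarrow> real) \<Rightarrow> real" where
  "H_comb k l = (\<Sum>i=1..m k. l i * H k i)"

definition G_comb :: "nat \<Rightarrow> (nat \<Rightarrow> real) \<Rightarrow> ('a \<Rightarrow>\<^sub>L real)" where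
  "G_comb k l = (\<Sum>i=1..m k. l i *\<^sub>R G k i)"

definition omega :: "nat \<Rightarrow> 'a \<Rightarrow> real \<Rightarrow> (nat \<Rightarrow> real) \<Rightarrow> real" where
  "omega k z \<tau> l =
     (\<tau> - A 1) / \<tau> * (H_comb k l + G_comb k l z) + h_hat k + g_hat k z
     + A 1 / \<tau> * (f (y 1) - h_hat 1 - g_hat 1 z)
     + gamma_of \<tau> / (2 * \<tau>) * (norm_B B (z - v 1))\<^sup>2"

text \<open>The minimum over \<open>z\<close> is the value at a minimizer; it is attained because \<open>gamma_of \<tau> > 0\<close> for
  \<open>\<tau> \<ge> A 1\<close>.\<close>

definition phi :: "nat \<Rightarrow> real \<Rightarrow> (nat \<Rightarrow> real) \<Rightarrow> real" where
  "phi k \<tau> l = omega k (ARG_MIN (\<lambda>z. omega k z \<tau> l) z. True) \<tau> l - f (y k)"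

definition phi' :: "nat \<Rightarrow> real \<Rightarrow> (nat \<Rightarrow> real) \<Rightarrow> real" where
  "phi' k \<tau> l = deriv (\<lambda>t. phi k t l) \<tau>"

text \<open>\<open>a_next k\<close>, \<open>a_bar_next k\<close> and \<open>gamma_bar_next k\<close> carry the index \<open>k + 1\<close> in the usual notation.\<close>

definition a_next :: "nat \<Rightarrow> real" where
  "a_next k = 1 / (L - \<mu>) * (\<gamma> k + \<mu> * A k + sqrt (\<gamma> k * (\<gamma> k + 2 * L * A k)))"

definition gamma_plus :: "nat \<Rightarrow> real" where
  "gamma_plus k = \<gamma> k + 2 * \<mu> * r * a_next k"

definition a_bar_next :: "nat \<Rightarrow> real" where
  "a_bar_next k = (1 + 2 * q * r) * a_next k + q * r * A k"

definition gamma_bar_next :: "nat \<Rightarrow> real" where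
  "gamma_bar_next k = gamma_plus k - \<mu> * a_bar_next k"

definition lam_init :: "nat \<Rightarrow> nat \<Rightarrow> real" where
  "lam_init k i =
     (if k = 1 then (if i = 1 then 1 else 0)
      else 1 / (A k + a_next k - A 1) *
           (if i = 1 then A k - A 1 else if i = 2 then a_next k else 0))"

definition rho :: "nat \<Rightarrow> ('a \<Rightarrow>\<^sub>L real)" where
  "rho k = (1 - A 1 / A k) *\<^sub>R G_comb k (lam k) + g_hat k - (A 1 / A k) *\<^sub>R g_hat 1"

text \<open>Step 2: \<open>model_ok k\<close> says that the model with index \<open>k + 1\<close> is admissible.\<close>

definition model_ok :: "nat \<Rightarrow> bool" where
  "model_ok k \<longleftrightarrow>
     (if k = 1 then m (k + 1) = 1 \<and> H (k + 1) 1 = h_bar (k + 1) \<and> G (k + 1) 1 = g_bar (k + 1)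
      else m (k + 1) \<ge> 2
        \<and> H (k + 1) 1 = H_comb k (lam k) \<and> G (k + 1) 1 = G_comb k (lam k)
        \<and> H (k + 1) 2 = h_bar (k + 1) \<and> G (k + 1) 2 = g_bar (k + 1)
        \<and> (\<forall>i\<in>{3..m (k + 1)}.
              (H (k + 1) i, G (k + 1) i) \<in> convex hull ((\<lambda>j. (h_bar j, g_bar j)) ` {1..k + 1})))"

end

text \<open>
  A run of the method in which the iterates \<open>1, \<dots>, K\<close> have been generated, with at most \<open>N\<close> inner
  steps per iteration.
\<close>

locale ogm_memory_run = ogm_memory_data f f' B L \<mu> xstar x y v A \<gamma> m H G lam
  for f :: "'a::euclidean_space \<Rightarrow> real" and f' B L \<mu> xstar x y v A \<gamma> m H G lam +
  fixes x0 :: 'a and N K :: nat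
  assumes A1_nonneg: "A 1 \<ge> 0"
    and gamma1_pos: "\<gamma> 1 > 0"
    and y_1: "y 1 = x0"
    and x_eq: "\<And>j. 1 \<le> j \<Longrightarrow> j \<le> K \<Longrightarrow> x j = y j - (1 / L) *\<^sub>R inv B (g j)"
    and y_step: "\<And>k. 1 \<le> k \<Longrightarrow> k < K \<Longrightarrow>
      y (k + 1) =
        inverse (r * A k * gamma_bar_next k + a_bar_next k * \<gamma> k) *\<^sub>R
          ((r * A k * gamma_bar_next k) *\<^sub>R x k + (a_bar_next k * \<gamma> k) *\<^sub>R v k)"
    and model_step: "\<And>k. 1 \<le> k \<Longrightarrow> k < K \<Longrightarrow> model_ok k"
    and newton_step: "\<And>k. 1 \<le> k \<Longrightarrow> k < K \<Longrightarrow>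
      newton_middle (phi (k + 1)) (phi' (k + 1)) (std_simplex (m (k + 1))) N
        (A k + a_next k) (lam_init k) (A k + a_next k) (lam (k + 1)) (A (k + 1))"
    and gamma_step: "\<And>k. 1 \<le> k \<Longrightarrow> k < K \<Longrightarrow>
      \<gamma> (k + 1) = \<gamma> 1 + 2 * \<mu> * r * (A (k + 1) - A 1)"
    and v_step: "\<And>k. 1 \<le> k \<Longrightarrow> k < K \<Longrightarrow>
      v (k + 1) = v 1 - (A (k + 1) / \<gamma> (k + 1)) *\<^sub>R inv B (rho (k + 1))"

end

theory Submission
  imports Defs
begin

text \<open>
  Write \<open>\<kappa> = \<mu> L / (L - \<mu>) = \<mu> r\<close>, let \<open>step p\<close> be the gradient step from \<open>p\<close>, and let \<open>gap p z\<close> be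
  \<open>\<parallel>f' p\<parallel>\<^sup>2 / (2 L) + \<kappa> / 2 * \<parallel>z - step p\<parallel>\<^sup>2\<close>. The interpolation inequality for strongly convex smooth
  functions says that the first-order model of \<open>f\<close> at \<open>p\<close> can be raised by \<open>gap p\<close> and still lies
  below \<open>f\<close> at the minimizer. The models of the method are convex combinations of these raised
  models, from which the common term \<open>\<kappa> / 2 * \<parallel>z - v 1\<parallel>\<^sup>2\<close> has been split off to keep them affine.

  The proof follows the potential \<open>\<tau> * omega k z \<tau> l\<close>, a quadratic in \<open>z\<close> of curvature \<open>gamma_of \<tau>\<close>.
  The assertion \<open>0 \<le> phi k \<tau> l\<close> says that this potential is everywhere at least \<open>\<tau> * f (y k)\<close>; as
  \<open>v k\<close> is its vertex, the bound then holds with the additional term \<open>\<gamma> k / 2 * \<parallel>z - v k\<parallel>\<^sup>2\<close>.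
  This is the invariant \<open>certified k\<close>. It passes from \<open>k\<close> to \<open>k + 1\<close> in two moves. First, at
  \<open>\<tau> = A k + a_next k\<close> with the initial weights (the memory-less step) the invariant at \<open>k\<close> and
  the interpolation inequality between \<open>y k\<close> and \<open>y (k + 1)\<close> leave a quadratic in \<open>z\<close> which, by the
  choice of \<open>a_next k\<close> and \<open>y (k + 1)\<close>, is a perfect square (\<open>quadratic_step\<close>, \<open>potential_lam_init\<close>).
  Second, the Newton scheme only ever accepts pairs with \<open>0 \<le> phi\<close>, and it only moves to the
  right (\<open>newton_middle_invariant\<close>). So, whatever weights the inner solver returns, the invariant holds
  at \<open>k + 1\<close> and \<open>A (k + 1)\<close> is at least the value \<open>A k + a_next k\<close> of the memory-less step.

  At the minimizer the models are at most \<open>f xstar\<close>, so the invariant becomes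
  \<open>A k * (f (y k) - f xstar - gap (y k) xstar) + \<gamma> k / 2 * \<parallel>xstar - v k\<parallel>\<^sup>2 \<le> D\<^sub>1\<close> (\<open>potential_bound\<close>).
  The rates are then lower bounds for \<open>A k\<close>, obtained from \<open>A k + a_next k \<le> A (k + 1)\<close>.
\<close>

section \<open>The geometry of the metric B\<close>

context ogm_problem
begin

definition grad :: "'a \<Rightarrow> 'a" where "grad p = inv B (f' p)"
definition step :: "'a \<Rightarrow> 'a" where "step p = p - (1 / L) *\<^sub>R grad p"
definition \<kappa> :: real where "\<kappa> = \<mu> * L / (L - \<mu>)"
definition gap :: "'a \<Rightarrow> 'a \<Rightarrow> real" where
  "gap p z = B (grad p) (grad p) / (2 * L) + \<kappa> / 2 * B (z - step p) (z - step p)"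

text \<open>Below \<open>f\<close> at the minimizer, where the gradient vanishes, but not in general elsewhere.\<close>
definition minorant :: "'a \<Rightarrow> 'a \<Rightarrow> real" where
  "minorant p z = f p + f' p (z - p) + gap p z"

lemmas B_simps = linear_add[OF B_linear] linear_diff[OF B_linear] linear_scale[OF B_linear]
  linear_neg[OF B_linear] linear_0[OF B_linear] blinfun.bilinear_simps

lemma B_nonneg: "0 \<le> B z z"
  using B_pos_def[of z] by (cases "z = 0") (auto simp: B_simps)

lemma norm_B_sq: "(norm_B B z)\<^sup>2 = B z z"
  by (simp add: norm_B_def B_nonneg)

text \<open>The dual space has no dimension in the sense of \<^class>\<open>euclidean_space\<close>, so surjectivity is
  obtained for the coordinate version \<open>T\<close> of \<open>B\<close>, an endomorphism of the primal space.\<close>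
lemma bij_B: "bij B"
proof (rule bijI)
  show "inj B"
    unfolding linear_injective_0[OF B_linear]
  proof (intro allI impI)
    fix z assume "B z = 0"
    then have "B z z = 0" by simp
    then show "z = 0" using B_pos_def[of z] by force
  qed
  define T where "T z = (\<Sum>i\<in>Basis. B z i *\<^sub>R i)" for z
  have T_inner: "T z \<bullet> i = B z i" if "i \<in> Basis" for z i
    using that by (simp add: T_def inner_sum_left inner_Basis if_distrib cong: if_cong)
  have lin: "linear T"
    by (rule linearI) (simp_all add: T_def B_simps scaleR_left.add sum.distrib scaleR_sum_right)
  have "inj T"
    unfolding linear_injective_0[OF lin]
  proof (intro allI impI)
    fix z assume "T z = 0"
    then have "B z i = 0" if "i \<in> Basis" for i using T_inner[OF that, of z] by simp
    then have "B z = 0" by (intro blinfun_euclidean_eqI) simp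
    then show "z = 0" using B_pos_def[of z] by force
  qed
  then have surjT: "surj T" by (rule linear_injective_imp_surjective[OF lin]) (rule refl)
  show "surj B"
  proof (rule surjI)
    fix h :: "'a \<Rightarrow>\<^sub>L real"
    define z where "z = inv T (\<Sum>i\<in>Basis. h i *\<^sub>R i)"
    have "T z = (\<Sum>i\<in>Basis. h i *\<^sub>R i)" using surjT by (simp add: z_def surj_f_inv_f)
    then have "B z i = h i" if "i \<in> Basis" for i
      using T_inner[OF that, of z] that by (simp add: inner_sum_left inner_Basis if_distrib cong: if_cong)
    then show "B (inv T (\<Sum>i\<in>Basis. h i *\<^sub>R i)) = h"
      unfolding z_def[symmetric] by (rule blinfun_euclidean_eqI)
  qed
qed

lemma B_inv: "B (inv B h) = h"
  using bij_B by (simp add: bij_is_surj surj_f_inv_f)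

lemma dual_norm_B_sq: "(dual_norm_B B h)\<^sup>2 = B (inv B h) (inv B h)"
  using B_nonneg[of "inv B h"] by (simp add: dual_norm_B_def B_inv)

lemma f'_grad: "f' p = B (grad p)"
  by (simp add: grad_def B_inv)

lemma \<kappa>_nonneg: "0 \<le> \<kappa>"
  using L_pos mu_nonneg mu_less_L by (simp add: \<kappa>_def)

lemma B_minus_commute: "B (p - z) (p - z) = B (z - p) (z - p)"
  by (simp add: B_simps)

lemma inv_B_scale: "inv B (c *\<^sub>R h) = c *\<^sub>R inv B h"
proof -
  have "inv B (c *\<^sub>R h) = inv B (B (c *\<^sub>R inv B h))" by (simp add: B_simps B_inv)
  then show ?thesis using bij_B by (simp add: bij_is_inj)
qed

section \<open>Interpolation inequalities\<close>

text \<open>At an arbitrary point \<open>p + t\<close> the lower bound from \<open>b\<close> is at most the upper bound from \<open>p\<close>. The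
  claim is this comparison for the \<open>t\<close> that makes it sharpest.\<close>
lemma interpolation:
  "f b + f' b (p - b) + B (grad p - grad b) (grad p - grad b) / (2 * L)
     + \<kappa> / 2 * B (step p - step b) (step p - step b) \<le> f p"
proof -
  define d where "d = L - \<mu>"
  define e where "e = p - b"
  define D where "D = grad p - grad b"
  (* the maximizer over t of the lower bound at p + t minus the upper bound there *)
  define t where "t = (1 / d) *\<^sub>R (\<mu> *\<^sub>R e - D)"
  define gb where "gb = grad b"
  have gp: "grad p = gb + D" and p: "p = b + e" by (simp_all add: D_def e_def gb_def)
  have d: "d > 0" and L: "L = d + \<mu>" using mu_less_L by (simp_all add: d_def)
  have lower: "\<mu> / 2 * B (e + t) (e + t) \<le> f (p + t) - f b - B gb (e + t)"
    using f_lower[of "p + t" b] by (simp add: norm_B_sq f'_grad gb_def e_def algebra_simps)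
  have upper: "f (p + t) - f p - B (gb + D) t \<le> L / 2 * B t t"
    using f_upper[of "p + t" p] by (simp add: norm_B_sq f'_grad gp)
  have "step p - step b = e - (1 / L) *\<^sub>R D"
    by (simp add: step_def e_def D_def algebra_simps)
  then have "B D D / (2 * L) + \<kappa> / 2 * B (step p - step b) (step p - step b)
      = B D D / (2 * L) + \<kappa> / 2 * B (e - (1 / L) *\<^sub>R D) (e - (1 / L) *\<^sub>R D)"
    by (simp only:)
  also have "\<dots> = B D D / (2 * L) + \<kappa> / 2 * (B e e - 2 / L * B e D + B D D / L\<^sup>2)"
    by (simp add: B_simps B_self_adjoint algebra_simps power2_eq_square)
  also have "\<dots> = \<mu> / 2 * B e e + (\<mu>\<^sup>2 * B e e - 2 * \<mu> * B e D + B D D) / (2 * d)"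
    using d L_pos unfolding \<kappa>_def d_def[symmetric]
    by (simp add: field_simps power2_eq_square) (simp add: L algebra_simps)
  also have "\<dots> = \<mu> / 2 * B e e + d / 2 * B t t"
  proof -
    have "d * B t t = (\<mu>\<^sup>2 * B e e - 2 * \<mu> * B e D + B D D) / d"
      using d by (simp add: t_def B_simps B_self_adjoint[of D e] add_divide_distrib
          diff_divide_distrib algebra_simps power2_eq_square)
    then show ?thesis using d by simp
  qed
  also have "\<dots> = \<mu> / 2 * B (e + t) (e + t) - B D t - L / 2 * B t t"
  proof -
    have "\<mu> *\<^sub>R e - D = d *\<^sub>R t" using d by (simp add: t_def)
    then have "B (\<mu> *\<^sub>R e - D) t = d * B t t" by (simp only: B_simps real_scaleR_def)
    then show ?thesis
      by (simp add: B_simps B_self_adjoint L algebra_simps add_divide_distrib diff_divide_distrib)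
  qed
  finally show ?thesis
    using lower upper unfolding D_def[symmetric] e_def[symmetric]
    by (simp add: B_simps f'_grad gb_def[symmetric])
qed

lemma descent: "f (step p) \<le> f p - B (grad p) (grad p) / (2 * L)"
proof -
  have "step p - p = - ((1 / L) *\<^sub>R grad p)" by (simp add: step_def)
  then have "f (step p) - f p + B (grad p) (grad p) / L \<le> L / 2 * (1 / L * (1 / L * B (grad p) (grad p)))"
    using f_upper[of "step p" p, unfolded norm_B_sq] by (simp add: f'_grad B_simps)
  also have "\<dots> = B (grad p) (grad p) / L - B (grad p) (grad p) / (2 * L)"
    using L_pos by (simp add: field_simps)
  finally show ?thesis by simp
qed

lemma grad_xstar: "grad xstar = 0"
proof (rule ccontr)
  assume "grad xstar \<noteq> 0"
  then have "0 < B (grad xstar) (grad xstar) / (2 * L)" using B_pos_def L_pos by simp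
  also have "\<dots> \<le> f xstar - f (step xstar)"
    using descent[of xstar] by simp
  finally show False using xstar_min[of "step xstar"] by simp
qed

lemma minorant_xstar: "minorant p xstar \<le> f xstar"
  using interpolation[of p xstar]
  by (simp add: minorant_def gap_def grad_xstar step_def B_simps)

lemma gap_xstar: "gap p xstar \<le> f p - f xstar"
  using interpolation[of xstar p] B_self_adjoint
  by (simp add: gap_def grad_xstar f'_grad step_def B_simps algebra_simps)

text \<open>Moving from \<open>p\<close> to \<open>step p\<close> cancels the mixed products of the two gradients; in this form the
  inequality links consecutive potentials.\<close>
lemma interpolation_step:
  "f b + f' b (step p - b) + B (grad b) (grad b) / (2 * L)
     + \<kappa> / 2 * B (step p - step b) (step p - step b) \<le> f p - B (grad p) (grad p) / (2 * L)"
proof -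
  have "f' b (p - b) + B (grad p - grad b) (grad p - grad b) / (2 * L)
    = f' b (step p - b) + B (grad b) (grad b) / (2 * L) + B (grad p) (grad p) / (2 * L)"
    using L_pos by (simp add: step_def f'_grad B_simps B_self_adjoint field_simps)
  then show ?thesis using interpolation[of b p] by linarith
qed

section \<open>Quadratic functions\<close>

lemma complete_square:
  fixes h :: "'a \<Rightarrow>\<^sub>L real"
  assumes "c > 0"
  shows "h z + c / 2 * B (z - p) (z - p)
    = (let w = p - (1 / c) *\<^sub>R inv B h in h w + c / 2 * B (w - p) (w - p) + c / 2 * B (z - w) (z - w))"
proof -
  define e where "e = inv B h"
  have h: "h = B e" by (simp add: e_def B_inv)
  have sym: "B p z = B z p" "B p e = B e p" "B z e = B e z" by (simp_all add: B_self_adjoint)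
  show ?thesis using assms unfolding Let_def e_def[symmetric] unfolding h
    by (simp add: B_simps sym) (simp add: field_simps)
qed

text \<open>
  The quadratic that remains when consecutive potentials are compared, in coordinates centred at
  \<open>y (k + 1)\<close>: \<open>u\<close>, \<open>w\<close> and \<open>t\<close> stand for \<open>x k\<close>, \<open>v k\<close> and the free point, and \<open>c\<close>, \<open>cp\<close>, \<open>cb\<close>, \<open>ab\<close>
  for \<open>\<gamma> k\<close>, \<open>gamma_plus k\<close>, \<open>gamma_bar_next k\<close>, \<open>a_bar_next k\<close>. The balance \<open>bal\<close> eliminates \<open>u\<close>, and the
  two quadratic relations \<open>cb2\<close> and \<open>ab2\<close> then make the expression equal to
  \<open>\<parallel>cp t + ab g - cb w\<parallel>\<^sup>2 / (2 cp)\<close>.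
\<close>
lemma quadratic_step:
  fixes A a c cp cb ab r :: real
  assumes r: "r = 1 + \<kappa> / L" and c: "c > 0" and a: "a \<ge> 0"
    and cp: "cp = c + 2 * \<kappa> * a" and ab: "ab = a + \<kappa> / L * (A + 2 * a)" and cb: "cb = cp - \<mu> * ab"
    and cb_pos: "cb > 0" and cb2: "cb\<^sup>2 = c * cp" and ab2: "L * ab\<^sup>2 = 2 * r * cp * (A + a)"
    and bal: "(r * A * cb) *\<^sub>R u + (ab * c) *\<^sub>R w = 0"
  shows "0 \<le> A * B g u + a * B g t + (A + a) / L * B g g + c / 2 * B (t - w) (t - w)
     + \<kappa> / 2 * (A * B (u + (1/L) *\<^sub>R g) (u + (1/L) *\<^sub>R g) - A * B (t - u) (t - u)
         + (A + 2 * a) * B (t + (1/L) *\<^sub>R g) (t + (1/L) *\<^sub>R g))"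
    (is "0 \<le> ?E")
proof -
  define b where "b = ab *\<^sub>R g - cb *\<^sub>R w"
  have cp_pos: "cp > 0" using c a \<kappa>_nonneg by (simp add: cp add_pos_nonneg)
  have r_pos: "r > 0" using \<kappa>_nonneg L_pos by (simp add: r add_pos_nonneg)
  have \<kappa>r: "\<kappa> = \<mu> * r" using mu_less_L L_pos by (simp add: r \<kappa>_def field_simps)
  have Au: "A * B p u = - (ab * c / (r * cb)) * B p w" for p
  proof -
    have "B p ((r * A * cb) *\<^sub>R u + (ab * c) *\<^sub>R w) = 0" by (simp add: bal B_simps)
    then show ?thesis using cb_pos r_pos by (simp add: B_simps field_simps)
  qed
  have cb_alt: "c + \<mu> * ab * c / cb = cb"
  proof -
    have "c * cb + \<mu> * ab * c = cb * cb" using cb2 by (simp add: cb algebra_simps power2_eq_square)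
    then show ?thesis using cb_pos by (simp add: field_simps)
  qed
  have "?E = cp / 2 * B t t + (ab * B t g - c * B t w + \<kappa> * (A * B t u))
      + (r * (A * B g u) + r * (A + a) / L * B g g + c / 2 * B w w)"
    using L_pos unfolding r cp ab
    by (simp add: B_simps B_self_adjoint field_simps power2_eq_square)
  also have "\<kappa> * (A * B t u) = - (\<mu> * ab * c / cb) * B t w"
    unfolding Au using r_pos cb_pos by (simp add: \<kappa>r)
  also have "ab * B t g - c * B t w + - (\<mu> * ab * c / cb) * B t w = ab * B t g - (c + \<mu> * ab * c / cb) * B t w"
    by (simp add: algebra_simps)
  also have "\<dots> = B t b"
    by (simp add: cb_alt b_def B_simps)
  also have "r * (A * B g u) = - (ab * c / cb) * B g w"
    unfolding Au using r_pos cb_pos by simp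
  also have "- (ab * c / cb) * B g w + r * (A + a) / L * B g g + c / 2 * B w w = B b b / (2 * cp)"
  proof -
    have 1: "c / cb = cb / cp" using cb2 cb_pos cp_pos by (simp add: field_simps power2_eq_square)
    have 2: "r * (A + a) / L = ab\<^sup>2 / (2 * cp)" using ab2 cp_pos L_pos by (simp add: field_simps)
    have 3: "c = cb\<^sup>2 / cp" using cb2 cp_pos by (simp add: field_simps)
    have "B b b = ab\<^sup>2 * B g g - 2 * ab * cb * B g w + cb\<^sup>2 * B w w"
      by (simp add: b_def B_simps B_self_adjoint algebra_simps power2_eq_square)
    then have "B b b / (2 * cp) = ab\<^sup>2 / (2 * cp) * B g g - ab * (cb / cp) * B g w + cb\<^sup>2 / cp / 2 * B w w"
      using cp_pos by (simp add: field_simps)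
    then show ?thesis unfolding 1[symmetric] 2[symmetric] 3[symmetric] by simp
  qed
  also have "cp / 2 * B t t + B t b + B b b / (2 * cp) = B (cp *\<^sub>R t + b) (cp *\<^sub>R t + b) / (2 * cp)"
    using cp_pos by (simp add: B_simps B_self_adjoint field_simps)
  finally show ?thesis using B_nonneg cp_pos by simp
qed

end

section \<open>The Newton middle scheme\<close>

text \<open>A step is taken only where \<open>\<phi> \<ge> 0\<close> and \<open>\<phi>' < 0\<close>, so the Newton update goes
  to the right, and every stored valid pair has \<open>\<phi> \<ge> 0\<close>.\<close>
lemma newton_middle_invariant:
  assumes "newton_middle \<phi> \<phi>' \<Lambda> n \<tau> lv \<tau>v l \<tau>o" "lv \<in> \<Lambda>" "0 \<le> \<phi> \<tau>v lv" "\<tau>v \<le> \<tau>"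
  shows "l \<in> \<Lambda> \<and> 0 \<le> \<phi> \<tau>o l \<and> \<tau>v \<le> \<tau>o"
  using assms
proof induction
  case (update l \<tau> n lo \<tau>o lv \<tau>v)
  have "\<phi> \<tau> l / \<phi>' \<tau> l \<le> 0" using update by (simp add: divide_nonneg_neg)
  then show ?case using update by force
qed auto

context ogm_memory_data
begin

section \<open>The step parameters\<close>

lemma \<kappa>_eq: "\<mu> * r = \<kappa>" and r_eq: "r = 1 + \<kappa> / L" and qr_eq: "q * r = \<kappa> / L"
  using L_pos mu_less_L by (simp_all add: r_def q_def \<kappa>_def field_simps)

lemma gamma_of_\<kappa>: "gamma_of \<tau> = \<gamma> 1 + 2 * \<kappa> * (\<tau> - A 1)"
  by (simp add: gamma_of_def \<kappa>_eq[symmetric])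

lemma a_next_root:
  assumes "\<gamma> k > 0" and "A k \<ge> 0"
  obtains s where "s \<ge> 0"
    "s\<^sup>2 = (\<gamma> k)\<^sup>2 + 2 * L * A k * \<gamma> k" "(L - \<mu>) * a_next k = \<gamma> k + \<mu> * A k + s"
proof
  show "(sqrt (\<gamma> k * (\<gamma> k + 2 * L * A k)))\<^sup>2 = (\<gamma> k)\<^sup>2 + 2 * L * A k * \<gamma> k"
    using assms L_pos by (simp add: algebra_simps power2_eq_square)
  show "(L - \<mu>) * a_next k = \<gamma> k + \<mu> * A k + sqrt (\<gamma> k * (\<gamma> k + 2 * L * A k))"
    using mu_less_L by (simp add: a_next_def)
  show "0 \<le> sqrt (\<gamma> k * (\<gamma> k + 2 * L * A k))"
    using assms L_pos by simp
qed

text \<open>The value \<open>a_next k\<close> is the larger root of a quadratic equation, and this equation yields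
  the coefficient relations \<open>cb2\<close> and \<open>ab2\<close> of \<open>quadratic_step\<close>. Everything is multiplied by
  \<open>d = L - \<mu>\<close>, which makes the parameters polynomial in \<open>s\<close>.\<close>
lemma step_parameters:
  assumes "\<gamma> k > 0" and "A k \<ge> 0"
  shows a_next_pos: "a_next k > 0" and a_bar_next_pos: "a_bar_next k > 0"
    and gamma_bar_next_pos: "gamma_bar_next k > 0"
    and gamma_bar_next_sq: "(gamma_bar_next k)\<^sup>2 = \<gamma> k * gamma_plus k"
    and a_bar_next_sq: "L * (a_bar_next k)\<^sup>2 = 2 * r * gamma_plus k * (A k + a_next k)"
proof -
  define d where "d = L - \<mu>"
  have d: "d > 0" using mu_less_L by (simp add: d_def)
  obtain s where s: "s \<ge> 0" "s\<^sup>2 = (\<gamma> k)\<^sup>2 + 2 * L * A k * \<gamma> k"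
    and da: "d * a_next k = \<gamma> k + \<mu> * A k + s"
    using a_next_root[OF assms] unfolding d_def by metis
  have "0 < d * a_next k" unfolding da using assms s mu_nonneg by (simp add: add_pos_nonneg)
  then show a: "a_next k > 0" using d by (simp add: zero_less_mult_iff)
  have dr: "d * r = L" using d by (simp add: r_def d_def)
  have dqr: "d * (q * r) = \<mu>" using d L_pos by (simp add: r_def q_def d_def)
  have "d * gamma_plus k = d * \<gamma> k + 2 * \<mu> * (d * r) * a_next k"
    unfolding gamma_plus_def by (simp add: algebra_simps)
  then have dgp: "d * gamma_plus k = d * \<gamma> k + 2 * \<mu> * L * a_next k"
    unfolding dr .
  have "d * a_bar_next k = d * a_next k + 2 * (d * (q * r)) * a_next k + d * (q * r) * A k"
    unfolding a_bar_next_def by (simp add: algebra_simps)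
  then have dab: "d * a_bar_next k = (L + \<mu>) * a_next k + \<mu> * A k"
    unfolding dqr by (simp add: d_def algebra_simps)
  have "0 < d * a_bar_next k" unfolding dab using a assms mu_nonneg L_pos by (simp add: add_pos_nonneg)
  then show "a_bar_next k > 0" using d by (simp add: zero_less_mult_iff)
  have "d * gamma_bar_next k = d * gamma_plus k - \<mu> * (d * a_bar_next k)"
    unfolding gamma_bar_next_def by (simp add: algebra_simps)
  also have "\<dots> = d * \<gamma> k + \<mu> * (d * a_next k) - \<mu>\<^sup>2 * A k"
    unfolding dgp dab by (simp add: d_def algebra_simps power2_eq_square)
  also have "\<dots> = L * \<gamma> k + \<mu> * s"
    unfolding da by (simp add: d_def algebra_simps power2_eq_square)
  finally have dgb: "d * gamma_bar_next k = L * \<gamma> k + \<mu> * s" .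
  have "0 < d * gamma_bar_next k" unfolding dgb using s assms mu_nonneg L_pos by (simp add: add_pos_nonneg)
  then show "gamma_bar_next k > 0" using d by (simp add: zero_less_mult_iff)
  have "d\<^sup>2 * (gamma_bar_next k)\<^sup>2 = (L * \<gamma> k + \<mu> * s)\<^sup>2"
    unfolding dgb[symmetric] by (simp add: power_mult_distrib)
  also have "\<dots> = L\<^sup>2 * (\<gamma> k)\<^sup>2 + 2 * L * \<gamma> k * \<mu> * s + \<mu>\<^sup>2 * ((\<gamma> k)\<^sup>2 + 2 * L * A k * \<gamma> k)"
    unfolding s(2)[symmetric] by (simp add: algebra_simps power2_eq_square)
  also have "\<dots> = \<gamma> k * (d\<^sup>2 * \<gamma> k + 2 * \<mu> * L * (d * a_next k))"
    unfolding da by (simp add: d_def algebra_simps power2_eq_square)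
  also have "\<dots> = d\<^sup>2 * (\<gamma> k * gamma_plus k)"
    using dgp by (simp add: power2_eq_square algebra_simps)
  finally show "(gamma_bar_next k)\<^sup>2 = \<gamma> k * gamma_plus k" using d by simp
  have root: "(d * a_next k)\<^sup>2 - 2 * (d * a_next k) * (\<gamma> k + \<mu> * A k) + \<mu>\<^sup>2 * (A k)\<^sup>2 = 2 * d * \<gamma> k * A k"
    using s(2) unfolding da by (simp add: d_def algebra_simps power2_eq_square)
  have "d\<^sup>2 * (L * (a_bar_next k)\<^sup>2) = L * ((L + \<mu>) * a_next k + \<mu> * A k)\<^sup>2"
    unfolding dab[symmetric] by (simp add: power_mult_distrib)
  also have "((L + \<mu>) * a_next k + \<mu> * A k)\<^sup>2 = 2 * (d * \<gamma> k + 2 * \<mu> * L * a_next k) * (A k + a_next k)"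
    using root by (simp add: d_def algebra_simps power2_eq_square)
  also have "L * (2 * (d * \<gamma> k + 2 * \<mu> * L * a_next k) * (A k + a_next k))
     = 2 * (d * r) * (d * gamma_plus k) * (A k + a_next k)"
    unfolding dgp dr by simp
  also have "\<dots> = d\<^sup>2 * (2 * r * gamma_plus k * (A k + a_next k))"
    by (simp add: power2_eq_square)
  finally show "L * (a_bar_next k)\<^sup>2 = 2 * r * gamma_plus k * (A k + a_next k)" using d by simp
qed

section \<open>The potential\<close>

text \<open>This is \<open>\<tau> * omega k z \<tau> l\<close>. The form without division also makes sense for \<open>\<tau> = 0\<close>, which
  occurs in the first iterate when \<open>A 1 = 0\<close>.\<close>
definition potential :: "nat \<Rightarrow> real \<Rightarrow> (nat \<Rightarrow> real) \<Rightarrow> 'a \<Rightarrow> real" where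
  "potential k \<tau> l z = (\<tau> - A 1) * (H_comb k l + G_comb k l z) + \<tau> * (h_hat k + g_hat k z)
     + A 1 * (f (y 1) - h_hat 1 - g_hat 1 z) + gamma_of \<tau> / 2 * B (z - v 1) (z - v 1)"

text \<open>With the quadratic term restored, the model is a convex combination of the functions
  \<open>minorant (y j)\<close> as soon as its entries are.\<close>
definition model :: "nat \<Rightarrow> (nat \<Rightarrow> real) \<Rightarrow> 'a \<Rightarrow> real" where
  "model k l z = H_comb k l + G_comb k l z + \<kappa> / 2 * B (z - v 1) (z - v 1)"

lemma omega_potential: "\<tau> > 0 \<Longrightarrow> \<tau> * omega k z \<tau> l = potential k \<tau> l z"
  by (simp add: omega_def potential_def norm_B_sq field_simps)

lemma potential_vertex:
  assumes "gamma_of \<tau> > 0"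
    and w: "w = v 1 - (1 / gamma_of \<tau>) *\<^sub>R
      inv B ((\<tau> - A 1) *\<^sub>R G_comb k l + \<tau> *\<^sub>R g_hat k - A 1 *\<^sub>R g_hat 1)"
  shows "potential k \<tau> l z = potential k \<tau> l w + gamma_of \<tau> / 2 * B (z - w) (z - w)"
proof -
  define h where "h = (\<tau> - A 1) *\<^sub>R G_comb k l + \<tau> *\<^sub>R g_hat k - A 1 *\<^sub>R g_hat 1"
  have pot: "potential k \<tau> l p = (\<tau> - A 1) * H_comb k l + \<tau> * h_hat k + A 1 * (f (y 1) - h_hat 1)
      + (h p + gamma_of \<tau> / 2 * B (p - v 1) (p - v 1))" for p
    by (simp add: potential_def h_def blinfun.bilinear_simps algebra_simps)
  show ?thesis
    using complete_square[OF assms(1), of h z "v 1"]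
    unfolding pot w h_def[symmetric] Let_def by simp
qed

lemma phi_nonneg_iff:
  assumes "\<tau> > 0" and "gamma_of \<tau> > 0"
  shows "0 \<le> phi k \<tau> l \<longleftrightarrow> (\<forall>z. \<tau> * f (y k) \<le> potential k \<tau> l z)"
proof -
  obtain w where w: "\<And>z. potential k \<tau> l z = potential k \<tau> l w + gamma_of \<tau> / 2 * B (z - w) (z - w)"
    using potential_vertex[OF assms(2)] by blast
  have min: "omega k w \<tau> l \<le> omega k z \<tau> l" for z
  proof -
    have "potential k \<tau> l w \<le> potential k \<tau> l z"
      using w[of z] assms(2) B_nonneg[of "z - w"] by simp
    then show ?thesis
      using assms(1) unfolding omega_potential[OF assms(1), symmetric] by simp
  qed
  define p where "p = (ARG_MIN (\<lambda>z. omega k z \<tau> l) z. True)"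
  have p: "omega k p \<tau> l \<le> omega k z \<tau> l" for z
    unfolding p_def by (rule arg_minI[where x = w]) (use min in \<open>auto simp: not_less\<close>)
  have "0 \<le> phi k \<tau> l \<longleftrightarrow> (\<forall>z. f (y k) \<le> omega k z \<tau> l)"
    using p unfolding phi_def p_def[symmetric] by (auto intro: order_trans)
  then show ?thesis
    using assms(1) unfolding omega_potential[OF assms(1), symmetric] by simp
qed

lemma sum_lam_init:
  fixes F :: "nat \<Rightarrow> 'b::real_vector"
  assumes "k \<noteq> 1" "m (k + 1) \<ge> 2" "A k + a_next k \<noteq> A 1"
  shows "(A k + a_next k - A 1) *\<^sub>R (\<Sum>i=1..m (k + 1). lam_init k i *\<^sub>R F i)
    = (A k - A 1) *\<^sub>R F 1 + a_next k *\<^sub>R F 2"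
proof -
  have split: "{1..m (k + 1)} = insert 1 (insert 2 {3..m (k + 1)})" using assms(2) by auto
  have "(\<Sum>i=3..m (k + 1). lam_init k i *\<^sub>R F i) = 0"
    using assms(1) by (intro sum.neutral) (auto simp: lam_init_def)
  then have "(\<Sum>i=1..m (k + 1). lam_init k i *\<^sub>R F i) = lam_init k 1 *\<^sub>R F 1 + lam_init k 2 *\<^sub>R F 2"
    unfolding split by simp
  then show ?thesis using assms by (simp add: lam_init_def scaleR_add_right)
qed

end

context ogm_memory_run
begin

lemma x_step: "1 \<le> j \<Longrightarrow> j \<le> K \<Longrightarrow> x j = step (y j)"
  by (simp add: x_eq step_def grad_def g_def)

text \<open>Completing the square: the reference point \<open>v 1\<close> enters the data of the method only through the
  quadratic that was split off to make them affine.\<close>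
lemma h_hat_gap:
  assumes "1 \<le> j" "j \<le> K"
  shows "h_hat j + g_hat j z = gap (y j) z - \<kappa> / 2 * B (z - v 1) (z - v 1)"
proof -
  have "h_hat j = \<kappa> / 2 * (B (step (y j)) (step (y j)) - B (v 1) (v 1)) + B (grad (y j)) (grad (y j)) / (2 * L)"
    by (simp add: h_hat_def \<kappa>_eq norm_B_sq dual_norm_B_sq g_def grad_def x_step[OF assms])
  moreover have "g_hat j z = \<kappa> * (B (v 1) z - B (step (y j)) z)"
    by (simp add: g_hat_def \<kappa>_eq x_step[OF assms] B_simps)
  ultimately show ?thesis by (simp add: gap_def B_simps B_self_adjoint algebra_simps)
qed

lemma h_bar_minorant:
  assumes "1 \<le> j" "j \<le> K"
  shows "h_bar j + g_bar j z = minorant (y j) z - \<kappa> / 2 * B (z - v 1) (z - v 1)"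
  using h_hat_gap[OF assms, of z]
  by (simp add: h_bar_def g_bar_def minorant_def g_def blinfun.bilinear_simps)

text \<open>The doubled slope of \<open>gamma_of\<close> is what makes all multiples of \<open>\<kappa> * \<parallel>z - v 1\<parallel>\<^sup>2\<close> cancel.\<close>
lemma potential_eq:
  assumes "1 \<le> k" "k \<le> K"
  shows "potential k \<tau> l z = (\<tau> - A 1) * model k l z + \<tau> * gap (y k) z
    + A 1 * (f (y 1) - gap (y 1) z) + \<gamma> 1 / 2 * B (z - v 1) (z - v 1)"
proof -
  have gaps: "gap (y k) z = h_hat k + g_hat k z + \<kappa> / 2 * B (z - v 1) (z - v 1)"
    "gap (y 1) z = h_hat 1 + g_hat 1 z + \<kappa> / 2 * B (z - v 1) (z - v 1)"
    using h_hat_gap[OF assms, of z] h_hat_gap[of 1 z] assms by simp_all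
  show ?thesis
    unfolding gaps potential_def model_def gamma_of_\<kappa>
    by (simp add: algebra_simps add_divide_distrib diff_divide_distrib)
qed

lemma gamma_of_pos: "A 1 \<le> \<tau> \<Longrightarrow> gamma_of \<tau> > 0"
  using gamma1_pos \<kappa>_nonneg by (simp add: gamma_of_\<kappa> add_pos_nonneg)

section \<open>The invariant\<close>

definition certified :: "nat \<Rightarrow> bool" where
  "certified k \<longleftrightarrow> A 1 \<le> A k \<and> \<gamma> k = gamma_of (A k) \<and>
    (\<forall>z. A k * f (y k) + \<gamma> k / 2 * B (z - v k) (z - v k) \<le> potential k (A k) (lam k) z)"

lemma certified_1: "certified 1"
  by (simp add: certified_def gamma_of_def potential_def algebra_simps)

lemma certified_pos: "certified k \<Longrightarrow> 0 \<le> A k" "certified k \<Longrightarrow> 0 < \<gamma> k"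
  using A1_nonneg gamma_of_pos by (auto simp: certified_def)

lemma certified_next:
  assumes "certified k"
  shows "a_next k > 0" "A 1 \<le> A k"
  using a_next_pos[OF certified_pos(2,1)[OF assms]] assms by (simp_all add: certified_def)

lemma model_lam_init:
  assumes "1 \<le> k" "k < K" "certified k"
  shows "(A k + a_next k - A 1) * model (k + 1) (lam_init k) z
    = (A k - A 1) * model k (lam k) z + a_next k * minorant (y (k + 1)) z"
proof (cases "k = 1")
  case True
  then show ?thesis using model_step[OF assms(1,2)] h_bar_minorant[of "k + 1" z] assms
    by (simp add: model_ok_def model_def H_comb_def G_comb_def lam_init_def)
next
  case False
  have ok: "m (k + 1) \<ge> 2" "H (k + 1) 1 = H_comb k (lam k)" "G (k + 1) 1 = G_comb k (lam k)"
    "H (k + 1) 2 = h_bar (k + 1)" "G (k + 1) 2 = g_bar (k + 1)"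
    using model_step[OF assms(1,2)] False by (auto simp: model_ok_def)
  have ne: "A k + a_next k \<noteq> A 1"
    using certified_next[OF assms(3)] by simp
  note sums = sum_lam_init[OF False ok(1) ne]
  have Hs: "(A k + a_next k - A 1) * H_comb (k + 1) (lam_init k)
      = (A k - A 1) * H_comb k (lam k) + a_next k * h_bar (k + 1)"
    using sums[of "H (k + 1)"] ok by (simp add: H_comb_def)
  have "(A k + a_next k - A 1) *\<^sub>R G_comb (k + 1) (lam_init k)
      = (A k - A 1) *\<^sub>R G_comb k (lam k) + a_next k *\<^sub>R g_bar (k + 1)"
    using sums[of "G (k + 1)"] ok by (simp add: G_comb_def)
  then have "blinfun_apply ((A k + a_next k - A 1) *\<^sub>R G_comb (k + 1) (lam_init k)) z
      = ((A k - A 1) *\<^sub>R G_comb k (lam k) + a_next k *\<^sub>R g_bar (k + 1)) z"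
    by simp
  then have Gs: "(A k + a_next k - A 1) * G_comb (k + 1) (lam_init k) z
      = (A k - A 1) * G_comb k (lam k) z + a_next k * g_bar (k + 1) z"
    by (simp add: blinfun.bilinear_simps)
  have "minorant (y (k + 1)) z = h_bar (k + 1) + g_bar (k + 1) z + \<kappa> / 2 * B (z - v 1) (z - v 1)"
    using h_bar_minorant[of "k + 1" z] assms by simp
  then show ?thesis
    unfolding model_def distrib_left Hs Gs
    by (simp add: algebra_simps add_divide_distrib diff_divide_distrib)
qed

text \<open>The memory-less step: passing to \<open>k + 1\<close> removes \<open>A k * gap (y k)\<close> from the potential and adds
  \<open>a_next k * minorant (y (k + 1))\<close> and \<open>(A k + a_next k) * gap (y (k + 1))\<close>. The removed gap is
  paid for by \<open>interpolation_step\<close>, and \<open>quadratic_step\<close> bounds the rest.\<close>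
lemma potential_lam_init:
  assumes "1 \<le> k" "k < K" "certified k"
  shows "(A k + a_next k) * f (y (k + 1)) \<le> potential (k + 1) (A k + a_next k) (lam_init k) z"
proof -
  define a where "a = a_next k"
  define p where "p = y (k + 1)"
  define u where "u = x k - p"
  define w where "w = v k - p"
  define t where "t = z - p"
  note pos = certified_pos[OF assms(3)]
  note params = step_parameters[OF pos(2,1)]
  define c1 where "c1 = r * A k * gamma_bar_next k"
  define c2 where "c2 = a_bar_next k * \<gamma> k"
  have "r > 0" using L_pos mu_less_L by (simp add: r_def)
  then have c: "c1 + c2 > 0" using pos params by (simp add: c1_def c2_def add_nonneg_pos)
  have "p = inverse (c1 + c2) *\<^sub>R (c1 *\<^sub>R x k + c2 *\<^sub>R v k)"
    using y_step[OF assms(1,2)] by (simp add: p_def c1_def c2_def)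
  then have "(c1 + c2) *\<^sub>R p = c1 *\<^sub>R x k + c2 *\<^sub>R v k"
    using c by simp
  then have bal: "c1 *\<^sub>R u + c2 *\<^sub>R w = 0"
    by (simp add: u_def w_def algebra_simps)
  have quad: "0 \<le> A k * B (grad p) u + a * B (grad p) t + (A k + a) / L * B (grad p) (grad p)
     + \<gamma> k / 2 * B (t - w) (t - w)
     + \<kappa> / 2 * (A k * B (u + (1/L) *\<^sub>R grad p) (u + (1/L) *\<^sub>R grad p) - A k * B (t - u) (t - u)
         + (A k + 2 * a) * B (t + (1/L) *\<^sub>R grad p) (t + (1/L) *\<^sub>R grad p))"
  proof (rule quadratic_step[OF r_eq pos(2)])
    show "gamma_plus k = \<gamma> k + 2 * \<kappa> * a"
      by (simp add: gamma_plus_def a_def \<kappa>_eq[symmetric])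
    show "a_bar_next k = a + \<kappa> / L * (A k + 2 * a)"
      by (simp add: a_bar_next_def qr_eq[symmetric] a_def algebra_simps)
    show "gamma_bar_next k = gamma_plus k - \<mu> * a_bar_next k"
      by (simp add: gamma_bar_next_def)
    show "(r * A k * gamma_bar_next k) *\<^sub>R u + (a_bar_next k * \<gamma> k) *\<^sub>R w = 0"
      using bal unfolding c1_def c2_def .
    show "0 \<le> a" using params(1) by (simp add: a_def)
    show "L * (a_bar_next k)\<^sup>2 = 2 * r * gamma_plus k * (A k + a)" unfolding a_def by (rule params)
  qed (rule params)+
  have xk: "x k = step (y k)" using x_step assms by simp
  have vecs: "step (y k) - p = u" "z - v k = t - w" "z - step (y k) = t - u"
    "z - step p = t + (1/L) *\<^sub>R grad p" "step (y k) - step p = u + (1/L) *\<^sub>R grad p" "z - p = t"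
    by (simp_all add: u_def w_def t_def xk step_def)
  have interp: "A k * (f p + B (grad p) u + B (grad p) (grad p) / (2 * L)
     + \<kappa> / 2 * B (u + (1/L) *\<^sub>R grad p) (u + (1/L) *\<^sub>R grad p))
    \<le> A k * (f (y k) - B (grad (y k)) (grad (y k)) / (2 * L))"
    by (rule mult_left_mono[OF interpolation_step[of p "y k", unfolded vecs f'_grad[of p]] pos(1)])
  have gap_k: "gap (y k) z = B (grad (y k)) (grad (y k)) / (2 * L) + \<kappa> / 2 * B (t - u) (t - u)"
    and gap_p: "gap p z = B (grad p) (grad p) / (2 * L)
      + \<kappa> / 2 * B (t + (1/L) *\<^sub>R grad p) (t + (1/L) *\<^sub>R grad p)"
    and min_p: "minorant p z = f p + B (grad p) t + gap p z"
    unfolding gap_def minorant_def vecs f'_grad[of p] by (rule refl)+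
  have k0: "1 \<le> k" "k \<le> K" and k1: "1 \<le> k + 1" "k + 1 \<le> K" using assms by simp_all
  have pot: "potential (k + 1) (A k + a) (lam_init k) z
      = potential k (A k) (lam k) z - A k * gap (y k) z + a * minorant p z + (A k + a) * gap p z"
  proof -
    have "potential (k + 1) (A k + a) (lam_init k) z
      = (A k - A 1) * model k (lam k) z + a * minorant p z + (A k + a) * gap p z
        + A 1 * (f (y 1) - gap (y 1) z) + \<gamma> 1 / 2 * B (z - v 1) (z - v 1)"
      unfolding a_def p_def potential_eq[OF k1] model_lam_init[OF assms] ..
    also have "\<dots> = potential k (A k) (lam k) z - A k * gap (y k) z + a * minorant p z + (A k + a) * gap p z"
      unfolding potential_eq[OF k0] by simp
    finally show ?thesis .
  qed
  have "(A k + a) * f p \<le> A k * f (y k) + \<gamma> k / 2 * B (t - w) (t - w) - A k * gap (y k) z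
      + a * minorant p z + (A k + a) * gap p z"
  proof -
    have arith: "(b + d) * fp \<le> b * fk + W - b * (gk + c * tu) + d * (fp + gt + (gg + c * tt))
        + (b + d) * (gg + c * tt)"
      if "0 \<le> b * gu + d * gt + 2 * (b + d) * gg + W + c * (b * uu - b * tu + (b + 2 * d) * tt)"
        "b * (fp + gu + gg + c * uu) \<le> b * (fk - gk)" for b d c fp fk gk gt gu gg uu tt tu W :: real
      using that by (simp add: algebra_simps)
    have "(A k + a) / L * B (grad p) (grad p) = 2 * (A k + a) * (B (grad p) (grad p) / (2 * L))"
      using L_pos by (simp add: field_simps)
    from arith[OF quad[unfolded this] interp] show ?thesis unfolding gap_k min_p gap_p .
  qed
  also have "\<dots> \<le> potential k (A k) (lam k) z - A k * gap (y k) z + a * minorant p z + (A k + a) * gap p z"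
  proof -
    have "A k * f (y k) + \<gamma> k / 2 * B (z - v k) (z - v k) \<le> potential k (A k) (lam k) z"
      using assms(3) unfolding certified_def by blast
    then show ?thesis unfolding vecs by linarith
  qed
  also have "\<dots> = potential (k + 1) (A k + a) (lam_init k) z" by (simp only: pot)
  finally show ?thesis by (simp only: a_def p_def)
qed

lemma lam_init_simplex:
  assumes "1 \<le> k" "k < K" "certified k"
  shows "lam_init k \<in> std_simplex (m (k + 1))"
proof (cases "k = 1")
  case True
  then show ?thesis using model_step[OF assms(1,2)]
    by (simp add: model_ok_def std_simplex_def lam_init_def)
next
  case False
  note a = certified_next(1)[OF assms(3)] and A = certified_next(2)[OF assms(3)]
  have "m (k + 1) \<ge> 2" using model_step[OF assms(1,2)] False by (auto simp: model_ok_def)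
  moreover have "A k + a_next k \<noteq> A 1" using a A by simp
  ultimately have "(A k + a_next k - A 1) * (\<Sum>i=1..m (k + 1). lam_init k i) = (A k - A 1) + a_next k"
    using sum_lam_init[of k "\<lambda>_. 1 :: real"] False by (simp only: real_scaleR_def mult_1_right not_False_eq_True)
  moreover have "A k + a_next k - A 1 > 0" using a A by simp
  ultimately have "(\<Sum>i=1..m (k + 1). lam_init k i) = 1"
    by (metis add_diff_eq diff_add_eq less_irrefl mult_cancel_left1)
  then show ?thesis using a A by (simp add: std_simplex_def lam_init_def)
qed

lemma certified_step:
  assumes "1 \<le> k" "k < K" "certified k"
  shows "lam (k + 1) \<in> std_simplex (m (k + 1)) \<and> A k + a_next k \<le> A (k + 1) \<and> certified (k + 1)"
proof -
  define \<tau> where "\<tau> = A (k + 1)"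
  note a = certified_next(1)[OF assms(3)]
    and A = certified_pos(1)[OF assms(3)] certified_next(2)[OF assms(3)]
  have "0 \<le> phi (k + 1) (A k + a_next k) (lam_init k)"
  proof (subst phi_nonneg_iff)
    show "0 < A k + a_next k" "0 < gamma_of (A k + a_next k)"
      using a A by (auto intro!: gamma_of_pos)
  qed (intro allI potential_lam_init[OF assms])
  from newton_middle_invariant[OF newton_step[OF assms(1,2)], OF lam_init_simplex[OF assms],
      OF this order_refl]
  have out: "lam (k + 1) \<in> std_simplex (m (k + 1))" "0 \<le> phi (k + 1) \<tau> (lam (k + 1))"
    "A k + a_next k \<le> \<tau>" unfolding \<tau>_def by blast+
  have \<tau>: "\<tau> > 0" "A 1 \<le> \<tau>" using out(3) a A by simp_all
  have \<gamma>: "\<gamma> (k + 1) = gamma_of \<tau>" using gamma_step[OF assms(1,2)] by (simp add: gamma_of_def \<tau>_def)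
  have rho: "\<tau> *\<^sub>R rho (k + 1)
    = (\<tau> - A 1) *\<^sub>R G_comb (k + 1) (lam (k + 1)) + \<tau> *\<^sub>R g_hat (k + 1) - A 1 *\<^sub>R g_hat 1"
    using \<tau>(1) unfolding rho_def \<tau>_def[symmetric]
    by (simp add: scaleR_add_right scaleR_diff_right diff_divide_distrib[symmetric] right_diff_distrib)
  have v: "v (k + 1) = v 1 - (1 / gamma_of \<tau>) *\<^sub>R inv B ((\<tau> - A 1) *\<^sub>R G_comb (k + 1) (lam (k + 1))
      + \<tau> *\<^sub>R g_hat (k + 1) - A 1 *\<^sub>R g_hat 1)"
    using v_step[OF assms(1,2)] unfolding rho[symmetric] inv_B_scale \<gamma> \<tau>_def[symmetric] by simp
  have "\<tau> * f (y (k + 1)) \<le> potential (k + 1) \<tau> (lam (k + 1)) (v (k + 1))"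
    using out(2) phi_nonneg_iff[OF \<tau>(1) gamma_of_pos[OF \<tau>(2)]] by blast
  then have "\<tau> * f (y (k + 1)) + gamma_of \<tau> / 2 * B (z - v (k + 1)) (z - v (k + 1))
      \<le> potential (k + 1) \<tau> (lam (k + 1)) z" for z
    unfolding potential_vertex[OF gamma_of_pos[OF \<tau>(2)] v, of z] by simp
  then have "certified (k + 1)"
    using \<tau>(2) unfolding certified_def \<gamma> \<tau>_def[symmetric] by blast
  then show ?thesis using out(1,3) unfolding \<tau>_def by blast
qed

lemma certified:
  assumes "1 \<le> k" "k \<le> K"
  shows "certified k"
  using assms
proof (induction k rule: dec_induct)
  case base
  show ?case by (rule certified_1)
next
  case (step n)
  then show ?case using certified_step[of n] by simp
qed

lemma A_growth: "1 \<le> k \<Longrightarrow> k < K \<Longrightarrow> A k + a_next k \<le> A (k + 1)"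
  using certified_step certified by simp

section \<open>Evaluation at the minimizer\<close>

text \<open>The affine inequality satisfied by the bundle elements \<open>(h_bar j, g_bar j)\<close> survives convex
  combinations. The aggregated first entry of a model inherits it from the preceding model, hence
  the induction.\<close>
lemma model_xstar:
  assumes "2 \<le> k" "k \<le> K"
  shows "model k (lam k) xstar \<le> f xstar"
proof -
  define s where "s = \<kappa> / 2 * B (xstar - v 1) (xstar - v 1)"
  have bar: "h_bar j + g_bar j xstar + s \<le> f xstar" if "1 \<le> j" "j \<le> K" for j
    using h_bar_minorant[OF that, of xstar] minorant_xstar[of "y j"] by (simp add: s_def)
  have comb: "model n (lam n) xstar \<le> f xstar"
    if n: "2 \<le> n" "n \<le> K" and entry: "\<And>i. i \<in> {1..m n} \<Longrightarrow> H n i + G n i xstar + s \<le> f xstar" for n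
  proof -
    have simplex: "\<And>i. i \<in> {1..m n} \<Longrightarrow> 0 \<le> lam n i" "(\<Sum>i=1..m n. lam n i) = 1"
      using certified_step[of "n - 1"] certified[of "n - 1"] n by (auto simp: std_simplex_def)
    have "model n (lam n) xstar = (\<Sum>i=1..m n. lam n i * (H n i + G n i xstar)) + (\<Sum>i=1..m n. lam n i) * s"
      by (simp add: model_def H_comb_def G_comb_def blinfun.sum_left blinfun.scaleR_left
          sum.distrib distrib_left simplex(2)[simplified] s_def)
    also have "\<dots> = (\<Sum>i=1..m n. lam n i * (H n i + G n i xstar + s))"
      by (simp add: sum.distrib distrib_left sum_distrib_right)
    also have "\<dots> \<le> (\<Sum>i=1..m n. lam n i * f xstar)"
      by (intro sum_mono mult_left_mono entry simplex)
    finally show ?thesis by (simp add: sum_distrib_right[symmetric] simplex(2)[simplified])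
  qed
  from assms show ?thesis
  proof (induction k rule: dec_induct)
    case base
    have "m 2 = 1" "H 2 1 = h_bar 2" "G 2 1 = g_bar 2"
      using model_step[of 1] base by (simp_all add: model_ok_def numeral_2_eq_2)
    then show ?case using base bar[of 2] by (intro comb) auto
  next
    case (step n)
    define S where "S = {(h, e :: 'a \<Rightarrow>\<^sub>L real). h + e xstar + s \<le> f xstar}"
    have "convex S"
    proof -
      have "S = (\<lambda>p. fst p + blinfun_apply (snd p) xstar) -` {..f xstar - s}" by (auto simp: S_def)
      moreover have "linear (\<lambda>p :: real \<times> ('a \<Rightarrow>\<^sub>L real). fst p + blinfun_apply (snd p) xstar)"
        by (rule linearI) (simp_all add: blinfun.bilinear_simps algebra_simps)
      ultimately show ?thesis by (simp add: convex_linear_vimage)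
    qed
    moreover have "(\<lambda>j. (h_bar j, g_bar j)) ` {1..n + 1} \<subseteq> S"
      using bar step by (auto simp: S_def)
    ultimately have hull: "convex hull ((\<lambda>j. (h_bar j, g_bar j)) ` {1..n + 1}) \<subseteq> S"
      by (intro hull_minimal)
    have ok: "model_ok n" and n: "n \<noteq> 1" using model_step[of n] step by auto
    have "H (n + 1) i + G (n + 1) i xstar + s \<le> f xstar" if "i \<in> {1..m (n + 1)}" for i
    proof -
      have "i = 1 \<or> i = 2 \<or> i \<in> {3..m (n + 1)}" using that by auto
      then consider "i = 1" | "i = 2" | "i \<in> {3..m (n + 1)}" by blast
      then show ?thesis
      proof cases
        case 1
        then show ?thesis using ok n step by (simp add: model_ok_def model_def s_def)
      next
        case 2
        then show ?thesis using ok n step bar[of "n + 1"] by (simp add: model_ok_def)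
      next
        case 3
        then have "(H (n + 1) i, G (n + 1) i) \<in> S" using ok n hull by (auto simp: model_ok_def)
        then show ?thesis by (simp add: S_def)
      qed
    qed
    then show ?case using step by (intro comb) auto
  qed
qed

definition D\<^sub>1 :: real where
  "D\<^sub>1 = A 1 * (f (y 1) - f xstar - gap (y 1) xstar) + \<gamma> 1 / 2 * B (xstar - v 1) (xstar - v 1)"

lemma potential_bound:
  assumes "2 \<le> k" "k \<le> K"
  shows "A k * (f (y k) - f xstar - gap (y k) xstar) + \<gamma> k / 2 * B (xstar - v k) (xstar - v k) \<le> D\<^sub>1"
proof -
  have c: "certified k" using certified assms by simp
  then have "A k * f (y k) + \<gamma> k / 2 * B (xstar - v k) (xstar - v k) \<le> potential k (A k) (lam k) xstar"
    unfolding certified_def by blast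
  also have "\<dots> = (A k - A 1) * model k (lam k) xstar + A k * gap (y k) xstar
    + A 1 * (f (y 1) - gap (y 1) xstar) + \<gamma> 1 / 2 * B (xstar - v 1) (xstar - v 1)"
    using potential_eq assms by simp
  also have "(A k - A 1) * model k (lam k) xstar \<le> (A k - A 1) * f xstar"
    using model_xstar[OF assms] c by (intro mult_left_mono) (auto simp: certified_def)
  finally show ?thesis by (simp add: D\<^sub>1_def algebra_simps)
qed

section \<open>Rates\<close>

text \<open>In terms of \<open>T k = 2 * L * A k / \<gamma> 1\<close> the recurrence is \<open>T (k + 1) \<ge> (1 + sqrt (1 + T k))\<^sup>2\<close>.
  In \<open>increment\<close>, \<open>b\<close> is a lower bound for that square root.\<close>
lemma A_quadratic_growth:
  assumes "\<mu> = 0" "2 \<le> k" "k \<le> K"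
  shows "\<gamma> 1 * (real k)\<^sup>2 \<le> 2 * L * A k"
proof -
  have increment: "2 * L * A j + 2 * \<gamma> 1 + 2 * \<gamma> 1 * b \<le> 2 * L * A (j + 1)"
    if j: "1 \<le> j" "j < K" and b: "0 \<le> b" "(\<gamma> 1)\<^sup>2 * b\<^sup>2 \<le> (\<gamma> 1)\<^sup>2 + 2 * L * A j * \<gamma> 1" for j b
  proof -
    have c: "certified j" using certified j by simp
    have "\<kappa> = 0" unfolding \<kappa>_def using assms(1) by simp
    then have \<gamma>: "\<gamma> j = \<gamma> 1" using c by (simp add: certified_def gamma_of_\<kappa>)
    have "\<gamma> 1 * b \<le> sqrt (\<gamma> 1 * (\<gamma> 1 + 2 * L * A j))"
      using b by (intro real_le_rsqrt) (simp add: power_mult_distrib power2_eq_square algebra_simps)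
    also have "\<gamma> 1 + \<dots> = L * a_next j"
      unfolding a_next_def \<gamma> using assms(1) L_pos by simp
    finally have "\<gamma> 1 + \<gamma> 1 * b \<le> L * a_next j" by simp
    moreover have "L * (A j + a_next j) \<le> L * A (j + 1)"
      using A_growth[OF j] L_pos by (intro mult_left_mono) auto
    ultimately show ?thesis by (simp add: algebra_simps)
  qed
  from assms(2,3) show ?thesis
  proof (induction k rule: dec_induct)
    case base
    have A1: "0 \<le> 2 * L * A 1" using A1_nonneg L_pos by simp
    then have "0 \<le> 2 * L * A 1 * \<gamma> 1" by (rule mult_nonneg_nonneg) (use gamma1_pos in simp)
    then have "2 * L * A 1 + 2 * \<gamma> 1 + 2 * \<gamma> 1 * 1 \<le> 2 * L * A (1 + 1)"
      using base by (intro increment) auto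
    then show ?case using A1 by (simp add: numeral_2_eq_2)
  next
    case (step n)
    have IH: "\<gamma> 1 * (real n)\<^sup>2 \<le> 2 * L * A n" using step by simp
    then have "\<gamma> 1 * (\<gamma> 1 * (real n)\<^sup>2) \<le> \<gamma> 1 * (2 * L * A n)"
      using gamma1_pos by (intro mult_left_mono) auto
    then have "(\<gamma> 1)\<^sup>2 * (real n)\<^sup>2 \<le> 2 * L * A n * \<gamma> 1"
      by (simp add: power2_eq_square algebra_simps)
    then have "(\<gamma> 1)\<^sup>2 * (real n)\<^sup>2 \<le> (\<gamma> 1)\<^sup>2 + 2 * L * A n * \<gamma> 1"
      using zero_le_power2[of "\<gamma> 1"] by linarith
    then have "2 * L * A n + 2 * \<gamma> 1 + 2 * \<gamma> 1 * real n \<le> 2 * L * A (n + 1)"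
      using step by (intro increment) auto
    then show ?case using IH gamma1_pos by (simp add: power2_eq_square algebra_simps)
  qed
qed

text \<open>For \<open>\<kappa> = 0\<close> the gap of \<open>y k\<close> is at most the decrease achieved by the gradient step to
  \<open>x k\<close>.\<close>
lemma rate_convex:
  assumes "\<mu> = 0" "2 \<le> k" "k \<le> K"
  shows "f (x k) - f xstar \<le> L / (real k)\<^sup>2 * (2 / \<gamma> 1 * D\<^sub>1)"
proof -
  have "0 \<le> \<gamma> k" using certified_pos(2)[of k] certified[of k] assms by simp
  then have v: "0 \<le> \<gamma> k / 2 * B (xstar - v k) (xstar - v k)" using B_nonneg by simp
  have "\<kappa> = 0" unfolding \<kappa>_def using assms(1) by simp
  then have "f (x k) - f xstar \<le> f (y k) - f xstar - gap (y k) xstar"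
    using descent[of "y k"] x_step[of k] assms(2,3) by (simp add: gap_def)
  moreover have "0 \<le> A k" using certified_pos(1)[of k] certified[of k] assms by simp
  ultimately have "A k * (f (x k) - f xstar) \<le> A k * (f (y k) - f xstar - gap (y k) xstar)"
    by (rule mult_left_mono)
  then have D: "A k * (f (x k) - f xstar) \<le> D\<^sub>1" using potential_bound[of k] assms v by simp
  have "\<gamma> 1 * (real k)\<^sup>2 * (f (x k) - f xstar) \<le> 2 * L * A k * (f (x k) - f xstar)"
    using A_quadratic_growth[OF assms] xstar_min by (intro mult_right_mono) auto
  also have "\<dots> \<le> 2 * L * D\<^sub>1" using D L_pos by simp
  finally show ?thesis using gamma1_pos assms by (simp add: field_simps)
qed

text \<open>The hypothesis on \<open>\<gamma> 1\<close> gives \<open>2 * \<kappa> * A k \<le> \<gamma> k\<close>. Inserting this bound into the formula for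
  \<open>a_next k\<close> turns the radicand into a perfect square, with \<open>e = sqrt q\<close>, and
  \<open>A k + a_next k\<close> is at least \<open>((1 + e) / (1 - e\<^sup>2))\<^sup>2 = 1 / (1 - e)\<^sup>2\<close> times \<open>A k\<close>.\<close>
lemma A_linear_growth:
  assumes mu: "\<mu> > 0" and \<gamma>1: "\<gamma> 1 \<ge> 2 * \<kappa> * A 1" and k: "1 \<le> k" "k < K"
  shows "A k \<le> (1 - sqrt q)\<^sup>2 * A (k + 1)"
proof -
  define e where "e = sqrt q"
  have q: "0 \<le> q" "q < 1" using mu mu_less_L by (simp_all add: q_def)
  then have e: "0 \<le> e" "e < 1" "e\<^sup>2 = q" by (simp_all add: e_def real_sqrt_less_iff[of q 1, simplified])
  have c: "certified k" using certified k by simp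
  note pos = certified_pos[OF c]
  have \<mu>: "\<mu> = e\<^sup>2 * L" using e(3) L_pos by (simp add: q_def)
  have Lmu: "L - \<mu> = (1 - e\<^sup>2) * L" by (simp add: \<mu> algebra_simps)
  have "1 - e\<^sup>2 = (1 - e) * (1 + e)" by (simp add: power2_eq_square algebra_simps)
  then have e1: "1 - e\<^sup>2 > 0" using e by simp
  have \<kappa>: "(1 - e\<^sup>2) * \<kappa> = e\<^sup>2 * L" using e1 L_pos unfolding \<kappa>_def Lmu by (simp add: \<mu>)
  have "\<gamma> k = \<gamma> 1 - 2 * \<kappa> * A 1 + 2 * \<kappa> * A k"
    using c by (simp add: certified_def gamma_of_\<kappa> algebra_simps)
  then have \<gamma>k: "2 * \<kappa> * A k \<le> \<gamma> k" using \<gamma>1 by simp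
  have \<gamma>e: "2 * e\<^sup>2 * L * A k \<le> (1 - e\<^sup>2) * \<gamma> k"
  proof -
    have "2 * e\<^sup>2 * L * A k = (1 - e\<^sup>2) * (2 * \<kappa> * A k)"
    proof -
      have "2 * (e\<^sup>2 * L) * A k = 2 * ((1 - e\<^sup>2) * \<kappa>) * A k" unfolding \<kappa> ..
      then show ?thesis by (simp only: mult_ac)
    qed
    also have "\<dots> \<le> (1 - e\<^sup>2) * \<gamma> k" using \<gamma>k e1 by (intro mult_left_mono) auto
    finally show ?thesis .
  qed
  obtain s where s: "s \<ge> 0" "s\<^sup>2 = (\<gamma> k)\<^sup>2 + 2 * L * A k * \<gamma> k"
    and da: "(L - \<mu>) * a_next k = \<gamma> k + \<mu> * A k + s"
    using a_next_root[OF pos(2,1)] by metis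
  have s_lower: "2 * e * L * A k \<le> (1 - e\<^sup>2) * s"
  proof (rule power2_le_imp_le)
    have "(2 * e * L * A k)\<^sup>2 = (2 * e\<^sup>2 * L * A k)\<^sup>2 + 2 * L * A k * (1 - e\<^sup>2) * (2 * e\<^sup>2 * L * A k)"
      by (simp add: power2_eq_square algebra_simps)
    also have "\<dots> \<le> ((1 - e\<^sup>2) * \<gamma> k)\<^sup>2 + 2 * L * A k * (1 - e\<^sup>2) * ((1 - e\<^sup>2) * \<gamma> k)"
      using \<gamma>e e e1 pos L_pos q by (intro add_mono power_mono mult_left_mono) auto
    also have "\<dots> = ((1 - e\<^sup>2) * s)\<^sup>2"
      unfolding power_mult_distrib s(2) by (simp add: power2_eq_square algebra_simps)
    finally show "(2 * e * L * A k)\<^sup>2 \<le> ((1 - e\<^sup>2) * s)\<^sup>2" .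
  qed (use s e1 in simp)
  have "L * ((1 + e)\<^sup>2 * A k)
      = (1 - e\<^sup>2) * ((1 - e\<^sup>2) * L * A k + \<mu> * A k) + 2 * e\<^sup>2 * L * A k + 2 * e * L * A k"
    by (simp add: \<mu> power2_eq_square algebra_simps)
  also have "\<dots> \<le> (1 - e\<^sup>2) * ((1 - e\<^sup>2) * L * A k + \<mu> * A k) + (1 - e\<^sup>2) * \<gamma> k + (1 - e\<^sup>2) * s"
    using \<gamma>e s_lower by simp
  also have "\<dots> = (1 - e\<^sup>2) * ((1 - e\<^sup>2) * L * A k) + (1 - e\<^sup>2) * ((L - \<mu>) * a_next k)"
    unfolding da by (simp add: algebra_simps)
  also have "\<dots> = L * ((1 + e)\<^sup>2 * ((1 - e)\<^sup>2 * (A k + a_next k)))"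
    unfolding Lmu by (simp add: power2_eq_square algebra_simps)
  finally have "L * ((1 + e)\<^sup>2 * A k) \<le> L * ((1 + e)\<^sup>2 * ((1 - e)\<^sup>2 * (A k + a_next k)))" .
  then have "A k \<le> (1 - e)\<^sup>2 * (A k + a_next k)" using L_pos e by simp
  also have "\<dots> \<le> (1 - e)\<^sup>2 * A (k + 1)" using A_growth[OF k] by (intro mult_left_mono) auto
  finally show ?thesis by (simp add: e_def)
qed

text \<open>The geometric growth starts at \<open>k = 2\<close>, since \<open>A 1\<close> may vanish.\<close>
lemma A_geometric:
  assumes "\<mu> > 0" "\<gamma> 1 \<ge> 2 * \<kappa> * A 1" "2 \<le> k" "k \<le> K"
  shows "2 * \<gamma> 1 / (L - \<mu>) \<le> (1 - sqrt q) ^ (2 * k - 4) * A k"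
  using assms(3,4)
proof (induction k rule: dec_induct)
  case base
  have pos: "0 < \<gamma> 1" "0 \<le> A 1" using gamma1_pos A1_nonneg by auto
  have "\<gamma> 1 = sqrt (\<gamma> 1 * \<gamma> 1)" using pos by simp
  also have "\<dots> \<le> sqrt (\<gamma> 1 * (\<gamma> 1 + 2 * L * A 1))"
    using pos L_pos by (intro real_sqrt_le_mono mult_left_mono) auto
  finally have "2 * \<gamma> 1 \<le> \<gamma> 1 + \<mu> * A 1 + sqrt (\<gamma> 1 * (\<gamma> 1 + 2 * L * A 1))"
    using mult_nonneg_nonneg[OF mu_nonneg pos(2)] by linarith
  then have "2 * \<gamma> 1 / (L - \<mu>) \<le> a_next 1"
    using mu_less_L by (simp add: a_next_def divide_right_mono)
  also have "\<dots> \<le> A 2" using A_growth[of 1] base pos by (simp add: numeral_2_eq_2)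
  finally show ?case by simp
next
  case (step n)
  have "2 * \<gamma> 1 / (L - \<mu>) \<le> (1 - sqrt q) ^ (2 * n - 4) * A n" using step by simp
  also have "\<dots> \<le> (1 - sqrt q) ^ (2 * n - 4) * ((1 - sqrt q)\<^sup>2 * A (n + 1))"
    using A_linear_growth[of n] assms step by (intro mult_left_mono) (auto simp: zero_le_power_eq)
  also have "\<dots> = (1 - sqrt q) ^ (2 * n - 4 + 2) * A (n + 1)" by (simp only: power_add mult.assoc)
  also have "2 * n - 4 + 2 = 2 * Suc n - 4" using step by simp
  finally show ?case by simp
qed

text \<open>Here \<open>gap_xstar\<close> makes the functional part of the potential nonnegative, and the distance is
  controlled by \<open>\<gamma> k \<ge> 2 * \<kappa> * A k\<close>.\<close>
lemma rate_strongly_convex: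
  assumes mu: "\<mu> > 0" and \<gamma>1: "\<gamma> 1 \<ge> 2 * \<kappa> * A 1" and k: "2 \<le> k" "k \<le> K"
  shows "B (v k - xstar) (v k - xstar)
    \<le> (1 - sqrt q) ^ (2 * k - 4) * ((1 - q)\<^sup>2 / (4 * q)) * (2 / \<gamma> 1 * D\<^sub>1)"
proof -
  define X where "X = B (xstar - v k) (xstar - v k)"
  define p where "p = (1 - sqrt q) ^ (2 * k - 4)"
  have X: "0 \<le> X" using B_nonneg by (simp add: X_def)
  have p: "0 \<le> p" using k by (simp add: p_def zero_le_power_eq)
  have \<kappa>: "\<kappa> > 0" using mu mu_less_L by (simp add: \<kappa>_def)
  have c: "certified k" using certified k by simp
  have "\<gamma> k = \<gamma> 1 - 2 * \<kappa> * A 1 + 2 * \<kappa> * A k"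
    using c by (simp add: certified_def gamma_of_\<kappa> algebra_simps)
  then have "\<kappa> * A k \<le> \<gamma> k / 2" using \<gamma>1 by simp
  then have "\<kappa> * A k * X \<le> \<gamma> k / 2 * X" using X by (rule mult_right_mono)
  also have "\<dots> \<le> D\<^sub>1"
  proof -
    have "0 \<le> A k * (f (y k) - f xstar - gap (y k) xstar)"
      using certified_pos(1)[OF c] gap_xstar[of "y k"] by simp
    then show ?thesis using potential_bound[OF k] by (simp add: X_def)
  qed
  finally have D: "\<kappa> * A k * X \<le> D\<^sub>1" .
  have "\<kappa> * (2 * \<gamma> 1 / (L - \<mu>)) * X \<le> \<kappa> * (p * A k) * X"
    using A_geometric[OF assms] \<kappa> X by (intro mult_right_mono mult_left_mono) (auto simp: p_def)
  also have "\<dots> \<le> p * D\<^sub>1" using mult_left_mono[OF D p] by (simp add: algebra_simps)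
  finally have main: "\<kappa> * (2 * \<gamma> 1 / (L - \<mu>)) * X \<le> p * D\<^sub>1" .
  define w where "w = \<kappa> * (2 * \<gamma> 1 / (L - \<mu>))"
  have w: "w > 0" using \<kappa> gamma1_pos mu_less_L by (simp add: w_def)
  have wq: "(1 - q)\<^sup>2 / (4 * q) * (2 / \<gamma> 1) = 1 / w"
  proof -
    have "1 - q = (L - \<mu>) / L" using L_pos by (simp add: q_def field_simps)
    then show ?thesis using mu mu_less_L L_pos gamma1_pos
      by (simp add: w_def \<kappa>_def q_def power2_eq_square)
  qed
  have "p * ((1 - q)\<^sup>2 / (4 * q)) * (2 / \<gamma> 1 * D\<^sub>1) = p * D\<^sub>1 * ((1 - q)\<^sup>2 / (4 * q) * (2 / \<gamma> 1))"
    by (simp only: mult_ac)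
  also have "\<dots> = p * D\<^sub>1 / w" unfolding wq by simp
  finally have "p * ((1 - q)\<^sup>2 / (4 * q)) * (2 / \<gamma> 1 * D\<^sub>1) = p * D\<^sub>1 / w" .
  moreover have "X \<le> p * D\<^sub>1 / w"
    using main w unfolding w_def[symmetric] by (simp add: field_simps)
  ultimately show ?thesis by (simp add: p_def X_def B_minus_commute[of "v k"])
qed

lemma value_bound: "f z - f xstar \<le> L / 2 * B (z - xstar) (z - xstar)"
  using f_upper[of z xstar, unfolded norm_B_sq] by (simp add: f'_grad grad_xstar B_simps)

end

theorem mainTheorem2:
  fixes f :: "'a::euclidean_space \<Rightarrow> real"
    and f' B :: "'a \<Rightarrow> ('a \<Rightarrow>\<^sub>L real)"
    and L \<mu> q r D1 D1_bar :: real
    and xstar x0 :: 'a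
    and x y v :: "nat \<Rightarrow> 'a"
    and A \<gamma> :: "nat \<Rightarrow> real"
    and m :: "nat \<Rightarrow> nat"
    and H :: "nat \<Rightarrow> nat \<Rightarrow> real"
    and G :: "nat \<Rightarrow> nat \<Rightarrow> ('a \<Rightarrow>\<^sub>L real)"
    and lam :: "nat \<Rightarrow> nat \<Rightarrow> real"
    and N K :: nat
  assumes run: "ogm_memory_run f f' B L \<mu> xstar x y v A \<gamma> m H G lam x0 N K"
    and q: "q = \<mu> / L"
    and r: "r = L / (L - \<mu>)"
    and D1: "D1 = A 1 * (f (y 1) - f xstar - \<mu> * r / 2 * (norm_B B (xstar - x 1))\<^sup>2
                         - 1 / (2 * L) * (dual_norm_B B (f' (y 1)))\<^sup>2)
                  + \<gamma> 1 / 2 * (norm_B B (v 1 - xstar))\<^sup>2"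
    and D1_bar: "D1_bar = 2 / \<gamma> 1 * D1"
  shows "(\<mu> = 0 \<longrightarrow>
            (\<forall>k. 2 \<le> k \<and> k \<le> K \<longrightarrow> f (x k) - f xstar \<le> L / (real k)\<^sup>2 * D1_bar)) \<and>
         (\<mu> > 0 \<and> \<gamma> 1 \<ge> 2 * \<mu> * r * A 1 \<longrightarrow>
            (\<forall>k. 2 \<le> k \<and> k \<le> K \<longrightarrow>
               (norm_B B (v k - xstar))\<^sup>2
                 \<le> (1 - sqrt q) ^ (2 * k - 4) * ((1 - q)\<^sup>2 / (4 * q)) * D1_bar \<and>
               f (v k) - f xstar
                 \<le> (1 - sqrt q) ^ (2 * k - 4) * ((1 - q)\<^sup>2 * L / (8 * q)) * D1_bar))"
proof -
  interpret ogm_memory_run f f' B L \<mu> xstar x y v A \<gamma> m H G lam x0 N K by (rule run)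
  show ?thesis
  proof (cases "2 \<le> K")
    case False
    then show ?thesis by auto
  next
    case True
    have eqs: "q = local.q" "r = local.r" by (simp_all add: q r local.q_def local.r_def)
    have D: "D1 = D\<^sub>1"
      using True x_step[of 1]
      by (simp add: D1 D\<^sub>1_def eqs \<kappa>_eq norm_B_sq dual_norm_B_sq gap_def grad_def[symmetric]
          B_minus_commute[of "v (Suc 0)" xstar] algebra_simps)
    have dist: "(norm_B B (v k - xstar))\<^sup>2
        \<le> (1 - sqrt q) ^ (2 * k - 4) * ((1 - q)\<^sup>2 / (4 * q)) * D1_bar"
      if "\<mu> > 0" "\<gamma> 1 \<ge> 2 * \<mu> * r * A 1" "2 \<le> k" "k \<le> K" for k
      using rate_strongly_convex[of k] that \<kappa>_eq
      by (simp add: norm_B_sq D1_bar D eqs mult.assoc[of 2])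
    have val: "f (v k) - f xstar
        \<le> (1 - sqrt q) ^ (2 * k - 4) * ((1 - q)\<^sup>2 * L / (8 * q)) * D1_bar"
      if "\<mu> > 0" "\<gamma> 1 \<ge> 2 * \<mu> * r * A 1" "2 \<le> k" "k \<le> K" for k
    proof -
      have "f (v k) - f xstar \<le> L / 2 * (norm_B B (v k - xstar))\<^sup>2"
        using value_bound by (simp add: norm_B_sq)
      also have "\<dots> \<le> L / 2 * ((1 - sqrt q) ^ (2 * k - 4) * ((1 - q)\<^sup>2 / (4 * q)) * D1_bar)"
        using dist[OF that] L_pos by (intro mult_left_mono) auto
      finally show ?thesis by (simp add: mult_ac)
    qed
    show ?thesis
      using rate_convex dist val by (simp add: D1_bar D)
  qed
qed

end
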